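(* Let $k\ge1$, let $\Sigma$ be a Borel probability measure on the set of $k\times k$ column-stochastic matrices, let $S_1,S_2,\dots$ be i.i.d. with law $\Sigma$, and let $Q_m=S_mS_{m-1}\cdots S_1$. Assume that with probability one the products $Q_m$ asymptotically collapse the simplex, that is, $\lim_{m\to\infty}\operatorname{diameter}(Q_m(\Delta_k))=0$ almost surely. Then there is a constant $K=K_\Sigma<\infty$ depending only on $\Sigma$ such that for every $\varepsilon\in(0,1)$ the mixing times of the EFCP chains on $[k]^{[n]}$ with paintbox measure $\Sigma$ satisfy $$t^{(n)}_{\mathrm{mix}}(\varepsilon)\le K\log n$$ for all sufficiently large $n$.
   Context: Notation: $[k]=\{1,\dots,k\}$; $\Delta_k=\{s\in\mathbb R^k:s_i\ge0,\ \sum_i s_i=1\}$, with Euclidean metric; a $k\times k$ matrix $S$ is column-stochastic if its columns lie in $\Delta_k$ (so $v\mapsto Sv$ maps $\Delta_k$ into itself); $S(a,b)$ is the entry in row $a$, column $b$. Elements of $[k]^{[n]}$ are written $x=x^1\cdots x^n$. The EFCP (exchangeable Feller cut-and-paste) chain on $[k]^{[n]}$ with paintbox measure $\Sigma$ is the time-homogeneous Markov chain with transition probabilities $P(x,y)=\int \prod_{i=1}^n S(y^i,x^i)\,\Sigma(dS)$. Under the collapse assumption it has a unique stationary distribution $\pi^{(n)}$. With $\mathcal D(X_m)$ the law of the chain at time $m$, $t^{(n)}_{\mathrm{mix}}(\varepsilon)=\min\{m\ge 1:\max_{x_0}\|\mathcal D(X_m)-\pi^{(n)}\|_{TV}<\varepsilon\}$,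 where the maximum is over initial states $X_0=x_0\in[k]^{[n]}$ and $\|\mu-\nu\|_{TV}=\frac12\sum_x|\mu(x)-\nu(x)|$. *)

theory Defs
  imports "HOL-Probability.Probability"
begin

text \<open>
  The alphabet \<open>[k]\<close> is a finite type \<open>'k\<close>, so \<open>k = CARD('k) \<ge> 1\<close>; the entry of a matrix
  \<open>S\<close> in row \<open>a\<close> and column \<open>b\<close> is \<open>S $ a $ b\<close>.
\<close>

definition prob_simplex :: "(real ^ 'k::finite) set" where
  "prob_simplex = {s. (\<forall>i. 0 \<le> s $ i) \<and> (\<Sum>i\<in>UNIV. s $ i) = 1}"

definition col_stochastic :: "(real ^ 'k::finite ^ 'k) set" where
  "col_stochastic = {S. \<forall>b. column b S \<in> prob_simplex}"

definition paintbox_measure :: "(real ^ 'k::finite ^ 'k) measure \<Rightarrow> bool" where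
  "paintbox_measure \<Sigma> \<longleftrightarrow>
     prob_space \<Sigma> \<and> sets \<Sigma> = sets (restrict_space borel col_stochastic)"

text \<open>\<open>left_prod S m\<close> is \<open>S\<^sub>m S\<^sub>m\<^sub>-\<^sub>1 \<cdots> S\<^sub>1\<close>; the value \<open>S 0\<close> is not used.\<close>

primrec left_prod :: "(nat \<Rightarrow> real ^ 'k::finite ^ 'k) \<Rightarrow> nat \<Rightarrow> real ^ 'k ^ 'k" where
  "left_prod S 0 = mat 1"
| "left_prod S (Suc m) = S (Suc m) ** left_prod S m"

definition collapses_simplex :: "(nat \<Rightarrow> real ^ 'k::finite ^ 'k) \<Rightarrow> bool" where
  "collapses_simplex S \<longleftrightarrow>
     (\<lambda>m. diameter ((\<lambda>v. left_prod S m *v v) ` prob_simplex)) \<longlonglongrightarrow> 0"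

text \<open>
  Elements of \<open>[k]\<^bsup>[n]\<^esup>\<close> are the functions on \<open>{1..n}\<close>, extended by \<open>undefined\<close> outside.
\<close>

definition states :: "nat \<Rightarrow> (nat \<Rightarrow> 'k) set" where
  "states n = {1..n} \<rightarrow>\<^sub>E UNIV"

definition efcp_prob ::
    "(real ^ 'k::finite ^ 'k) measure \<Rightarrow> nat \<Rightarrow> (nat \<Rightarrow> 'k) \<Rightarrow> (nat \<Rightarrow> 'k) \<Rightarrow> real" where
  "efcp_prob \<Sigma> n x y = (\<integral>S. (\<Prod>i\<in>{1..n}. S $ y i $ x i) \<partial>\<Sigma>)"

text \<open>
  The row \<open>P(x, \<cdot>)\<close> of the transition matrix as a probability mass function; the lemma
  \<open>pmf_efcp_step\<close> below shows that \<open>embed_pmf\<close> is applied to a genuine mass function.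
\<close>

definition efcp_step ::
    "(real ^ 'k::finite ^ 'k) measure \<Rightarrow> nat \<Rightarrow> (nat \<Rightarrow> 'k) \<Rightarrow> (nat \<Rightarrow> 'k) pmf" where
  "efcp_step \<Sigma> n x = embed_pmf (\<lambda>y. if y \<in> states n then efcp_prob \<Sigma> n x y else 0)"

text \<open>The law of \<open>X\<^sub>m\<close> for the chain started at \<open>X\<^sub>0 = x0\<close>.\<close>

primrec efcp_law ::
    "(real ^ 'k::finite ^ 'k) measure \<Rightarrow> nat \<Rightarrow> (nat \<Rightarrow> 'k) \<Rightarrow> nat \<Rightarrow> (nat \<Rightarrow> 'k) pmf" where
  "efcp_law \<Sigma> n x0 0 = return_pmf x0"
| "efcp_law \<Sigma> n x0 (Suc m) = bind_pmf (efcp_law \<Sigma> n x0 m) (efcp_step \<Sigma> n)"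

definition efcp_stationary ::
    "(real ^ 'k::finite ^ 'k) measure \<Rightarrow> nat \<Rightarrow> (nat \<Rightarrow> 'k) pmf \<Rightarrow> bool" where
  "efcp_stationary \<Sigma> n \<pi> \<longleftrightarrow>
     set_pmf \<pi> \<subseteq> states n \<and> bind_pmf \<pi> (efcp_step \<Sigma> n) = \<pi>"

text \<open>Meaningful when the stationary distribution is unique, as it is under collapse.\<close>

definition efcp_pi :: "(real ^ 'k::finite ^ 'k) measure \<Rightarrow> nat \<Rightarrow> (nat \<Rightarrow> 'k) pmf" where
  "efcp_pi \<Sigma> n = (THE \<pi>. efcp_stationary \<Sigma> n \<pi>)"

definition tv_dist :: "nat \<Rightarrow> (nat \<Rightarrow> 'k::finite) pmf \<Rightarrow> (nat \<Rightarrow> 'k) pmf \<Rightarrow> real" where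
  "tv_dist n \<mu> \<nu> = (1 / 2) * (\<Sum>x\<in>states n. \<bar>pmf \<mu> x - pmf \<nu> x\<bar>)"

text \<open>
  The minimum is taken in \<open>enat\<close>, so that the mixing time is \<open>\<infinity>\<close> if no \<open>m\<close> qualifies;
  otherwise the infimum is attained.
\<close>

definition efcp_tmix :: "(real ^ 'k::finite ^ 'k) measure \<Rightarrow> nat \<Rightarrow> real \<Rightarrow> enat" where
  "efcp_tmix \<Sigma> n \<epsilon> =
     (INF m\<in>{m. 1 \<le> m \<and>
        (MAX x0\<in>states n. tv_dist n (efcp_law \<Sigma> n x0 m) (efcp_pi \<Sigma> n)) < \<epsilon>}. enat m)"

lemma finite_states: "finite (states n :: (nat \<Rightarrow> 'k::finite) set)"
  by (simp add: states_def finite_PiE)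

lemma col_stochastic_nonneg: "S \<in> col_stochastic \<Longrightarrow> 0 \<le> S $ a $ b"
  by (simp add: col_stochastic_def prob_simplex_def column_def)

lemma col_stochastic_sum: "S \<in> col_stochastic \<Longrightarrow> (\<Sum>a\<in>UNIV. S $ a $ b) = 1"
  by (simp add: col_stochastic_def prob_simplex_def column_def)

lemma col_stochastic_le_1: "S \<in> col_stochastic \<Longrightarrow> S $ a $ b \<le> 1"
  using member_le_sum[of a UNIV "\<lambda>a. S $ a $ b"]
  by (simp add: col_stochastic_nonneg col_stochastic_sum)

lemma space_paintbox: "paintbox_measure \<Sigma> \<Longrightarrow> space \<Sigma> = col_stochastic"
  using sets_eq_imp_space_eq[of \<Sigma> "restrict_space borel col_stochastic"]
  by (simp add: paintbox_measure_def space_restrict_space)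

lemma efcp_integrable:
  fixes \<Sigma> :: "(real ^ 'k::finite ^ 'k) measure"
  assumes "paintbox_measure \<Sigma>"
  shows "integrable \<Sigma> (\<lambda>S. \<Prod>i\<in>{1..n}. S $ y i $ x i)"
proof -
  interpret prob_space \<Sigma> using assms by (simp add: paintbox_measure_def)
  have "(\<lambda>S :: real ^ 'k ^ 'k. \<Prod>i\<in>{1..n}. S $ y i $ x i) \<in> borel_measurable borel"
    by (rule borel_measurable_prod)
      (intro borel_measurable_continuous_onI continuous_on_component continuous_on_id)
  then have meas: "(\<lambda>S. \<Prod>i\<in>{1..n}. S $ y i $ x i) \<in> borel_measurable \<Sigma>"
    using assms measurable_cong_sets[of \<Sigma> "restrict_space borel col_stochastic" borel borel]
    by (auto simp: paintbox_measure_def intro: measurable_restrict_space1)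
  show ?thesis
  proof (rule integrable_const_bound[where B = 1])
    show "AE S in \<Sigma>. norm (\<Prod>i\<in>{1..n}. S $ y i $ x i) \<le> 1"
      by (rule AE_I2)
        (auto simp: space_paintbox[OF assms] abs_prod col_stochastic_nonneg col_stochastic_le_1
          intro!: prod_le_1)
  qed (rule meas)
qed

lemma efcp_prob_nonneg:
  assumes "paintbox_measure \<Sigma>"
  shows "0 \<le> efcp_prob \<Sigma> n x y"
  unfolding efcp_prob_def
  by (rule Bochner_Integration.integral_nonneg)
    (auto simp: space_paintbox[OF assms] col_stochastic_nonneg intro!: prod_nonneg)

lemma efcp_prob_sum:
  assumes "paintbox_measure \<Sigma>"
  shows "(\<Sum>y\<in>states n. efcp_prob \<Sigma> n x y) = 1"
proof -
  interpret prob_space \<Sigma> using assms by (simp add: paintbox_measure_def)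
  have "(\<Sum>y\<in>states n. efcp_prob \<Sigma> n x y) =
      (\<integral>S. (\<Sum>y\<in>states n. \<Prod>i\<in>{1..n}. S $ y i $ x i) \<partial>\<Sigma>)"
    unfolding efcp_prob_def
    by (rule Bochner_Integration.integral_sum[symmetric]) (rule efcp_integrable[OF assms])
  also have "\<dots> = (\<integral>S. 1 \<partial>\<Sigma>)"
  proof (rule Bochner_Integration.integral_cong[OF refl])
    fix S assume "S \<in> space \<Sigma>"
    then show "(\<Sum>y\<in>states n. \<Prod>i\<in>{1..n}. S $ y i $ x i) = 1"
      unfolding states_def
      by (subst prod_sum_PiE[symmetric])
        (auto simp: space_paintbox[OF assms] col_stochastic_sum)
  qed
  finally show ?thesis by (simp add: prob_space)
qed

lemma pmf_efcp_step:
  assumes "paintbox_measure \<Sigma>"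
  shows "pmf (efcp_step \<Sigma> n x) y = (if y \<in> states n then efcp_prob \<Sigma> n x y else 0)"
  unfolding efcp_step_def
proof (rule pmf_embed_pmf)
  let ?f = "\<lambda>y. if y \<in> states n then efcp_prob \<Sigma> n x y else 0"
  have "(\<integral>\<^sup>+ y. ennreal (?f y) \<partial>count_space UNIV) = (\<Sum>y\<in>states n. ennreal (?f y))"
    by (rule nn_integral_count_space'[OF finite_states]) auto
  also have "\<dots> = ennreal (\<Sum>y\<in>states n. efcp_prob \<Sigma> n x y)"
    by (subst sum_ennreal[symmetric]) (auto simp: efcp_prob_nonneg[OF assms])
  also have "\<dots> = 1" by (simp add: efcp_prob_sum[OF assms])
  finally show "(\<integral>\<^sup>+ y. ennreal (?f y) \<partial>count_space UNIV) = 1" .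
qed (auto simp: efcp_prob_nonneg[OF assms])

end

theory Submission
  imports Defs
begin

text \<open>
  The sum \<open>C(A)\<close> of the distances between the columns of \<open>A\<close> is submultiplicative on
  column-stochastic matrices and is bounded by a multiple of the diameter of \<open>A(\<Delta>\<^sub>k)\<close>. By
  dominated convergence and independence, \<open>c\<^sub>m = E C(Q\<^sub>m)\<close> tends to \<open>0\<close> and satisfies
  \<open>c\<^sub>m\<^sub>+\<^sub>l \<le> c\<^sub>m c\<^sub>l\<close>, so it decays exponentially. Given \<open>Q\<^sub>m\<close>, the coordinates of \<open>X\<^sub>m\<close> are
  independent, the \<open>i\<close>-th one being distributed as column \<open>x\<^sub>0\<^sup>i\<close> of \<open>Q\<^sub>m\<close>; hence the laws of \<open>X\<^sub>m\<close> from two starting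
  points are within \<open>n k c\<^sub>m\<close> in total variation, which is \<open>O(1/n)\<close> once \<open>m\<close> is a large enough
  multiple of \<open>log n\<close>.
\<close>

subsection \<open>Column-stochastic matrices\<close>

lemma mult_vec_prob_simplex:
  assumes "A \<in> col_stochastic" "v \<in> prob_simplex"
  shows "A *v v \<in> prob_simplex"
proof -
  have "(\<Sum>i\<in>UNIV. (A *v v) $ i) = (\<Sum>j\<in>UNIV. (\<Sum>i\<in>UNIV. A $ i $ j) * v $ j)"
    by (simp add: matrix_vector_mult_def sum_distrib_right) (rule sum.swap)
  also have "\<dots> = 1"
    using assms by (simp add: col_stochastic_sum prob_simplex_def)
  finally show ?thesis
    using assms
    by (auto simp: prob_simplex_def matrix_vector_mult_def col_stochastic_nonneg
        intro!: sum_nonneg mult_nonneg_nonneg)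
qed

lemma column_matrix_mult: "column b (A ** B) = A *v column b B"
  by (simp add: vec_eq_iff column_def matrix_matrix_mult_def matrix_vector_mult_def)

lemma col_stochastic_mult:
  "A \<in> col_stochastic \<Longrightarrow> B \<in> col_stochastic \<Longrightarrow> A ** B \<in> col_stochastic"
  using mult_vec_prob_simplex[of A]
  by (simp add: col_stochastic_def column_matrix_mult)

lemma col_stochastic_mat_1: "mat 1 \<in> col_stochastic"
  by (auto simp: col_stochastic_def prob_simplex_def column_def mat_def)

lemma axis_prob_simplex: "axis i 1 \<in> prob_simplex"
  by (auto simp: prob_simplex_def axis_def)

lemma norm_prob_simplex_le: "v \<in> prob_simplex \<Longrightarrow> norm v \<le> 1"
  using norm_le_l1_cart[of v] by (simp add: prob_simplex_def)

text \<open>Vanishes exactly when all columns agree, that is, when \<open>A\<close> maps the whole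
  simplex to one point. A sum over ordered pairs is evidently continuous in \<open>A\<close> and
  adds up estimates made pair by pair; compared with a maximum it costs only a factor depending on
  \<open>CARD('k)\<close>.\<close>

definition col_spread :: "real ^ 'k::finite ^ 'k \<Rightarrow> real" where
  "col_spread A = (\<Sum>a\<in>UNIV. \<Sum>b\<in>UNIV. norm (column a A - column b A))"

lemma col_spread_nonneg: "0 \<le> col_spread A"
  by (simp add: col_spread_def sum_nonneg)

lemma norm_column_diff_le: "norm (column a A - column b A) \<le> col_spread A"
proof -
  have "norm (column a A - column b A) \<le> (\<Sum>b\<in>UNIV. norm (column a A - column b A))"
    by (rule member_le_sum) auto
  also have "\<dots> \<le> col_spread A"
    unfolding col_spread_def
    by (rule member_le_sum[where f = "\<lambda>a. \<Sum>b\<in>UNIV. norm (column a A - column b A)"])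
      (auto intro: sum_nonneg)
  finally show ?thesis .
qed

text \<open>Since the coordinates of \<open>v\<close> sum to zero, one fixed column \<open>b\<close>
  may be subtracted from every column of \<open>A\<close> without changing \<open>A *v v\<close>.
  What remains is a combination of column differences with coefficients of size at most
  \<open>norm v\<close>.\<close>

lemma norm_mult_zero_sum:
  fixes A :: "real ^ 'k::finite ^ 'k"
  assumes "(\<Sum>i\<in>UNIV. v $ i) = 0"
  shows "norm (A *v v) \<le> col_spread A * norm v"
proof -
  fix b :: 'k
  have "A *v v = (\<Sum>a\<in>UNIV. v $ a *\<^sub>R column a A) - (\<Sum>a\<in>UNIV. v $ a) *\<^sub>R column b A"
    by (simp add: assms matrix_mult_sum scalar_mult_eq_scaleR)
  also have "\<dots> = (\<Sum>a\<in>UNIV. v $ a *\<^sub>R (column a A - column b A))"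
    by (simp add: scaleR_sum_left scaleR_diff_right sum_subtractf)
  also have "norm \<dots> \<le> (\<Sum>a\<in>UNIV. norm v * norm (column a A - column b A))"
    by (rule sum_norm_le) (auto simp: component_le_norm_cart intro!: mult_right_mono)
  also have "\<dots> \<le> norm v * col_spread A"
    unfolding col_spread_def sum_distrib_left[symmetric]
    by (intro mult_left_mono sum_mono member_le_sum) auto
  finally show ?thesis by (simp add: mult.commute)
qed

text \<open>The columns of \<open>A ** B\<close> are the images under \<open>A\<close> of the
  columns of \<open>B\<close>. Two columns of \<open>B\<close> both have coordinate sum 1, so their
  difference has sum zero and \<open>norm_mult_zero_sum\<close> applies to it.\<close>

lemma col_spread_mult:
  assumes "B \<in> col_stochastic"
  shows "col_spread (A ** B) \<le> col_spread A * col_spread B"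
proof -
  have "norm (column a (A ** B) - column b (A ** B)) \<le> col_spread A * norm (column a B - column b B)"
    for a b
    using norm_mult_zero_sum[of "column a B - column b B" A] assms
    by (simp add: column_matrix_mult matrix_vector_mult_diff_distrib sum_subtractf
        col_stochastic_def prob_simplex_def)
  then have "col_spread (A ** B) \<le>
      (\<Sum>a\<in>UNIV. \<Sum>b\<in>UNIV. col_spread A * norm (column a B - column b B))"
    unfolding col_spread_def[of "A ** B"] by (intro sum_mono)
  then show ?thesis by (simp add: col_spread_def[of B] sum_distrib_left)
qed

text \<open>The columns of \<open>A\<close> are the images of the vertices of the simplex, and there
  are \<open>CARD('k)\<close> squared ordered pairs of them. Boundedness of the image is what lets
  \<open>diameter\<close> bound distances.\<close>

lemma col_spread_le_diameter:
  fixes A :: "real ^ 'k::finite ^ 'k"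
  assumes "A \<in> col_stochastic"
  shows "col_spread A \<le> (real CARD('k))\<^sup>2 * diameter ((\<lambda>v. A *v v) ` prob_simplex)"
proof -
  have "bounded ((\<lambda>v. A *v v) ` prob_simplex)"
    using mult_vec_prob_simplex[OF assms] norm_prob_simplex_le by (fastforce simp: bounded_iff)
  moreover have "column a A \<in> (\<lambda>v. A *v v) ` prob_simplex" for a
    by (rule image_eqI[where x = "axis a 1"]) (simp_all only: axis_prob_simplex matrix_vector_mult_basis)
  ultimately have "norm (column a A - column b A) \<le> diameter ((\<lambda>v. A *v v) ` prob_simplex)" for a b
    unfolding dist_norm[symmetric] by (blast intro: diameter_bounded_bound)
  then have "col_spread A \<le> (\<Sum>a\<in>(UNIV::'k set). \<Sum>b\<in>(UNIV::'k set). diameter ((\<lambda>v. A *v v) ` prob_simplex))"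
    unfolding col_spread_def by (intro sum_mono)
  then show ?thesis by (simp add: power2_eq_square mult.assoc)
qed

text \<open>Provides the constant that dominates in integrability and dominated convergence.\<close>

lemma col_spread_le:
  fixes A :: "real ^ 'k::finite ^ 'k"
  assumes "A \<in> col_stochastic"
  shows "col_spread A \<le> 2 * (real CARD('k))\<^sup>2"
proof -
  have "norm (column a A - column b A) \<le> 2" for a b
    using norm_triangle_ineq4[of "column a A" "column b A"] assms
      norm_prob_simplex_le[of "column a A"] norm_prob_simplex_le[of "column b A"]
    by (simp add: col_stochastic_def)
  then have "col_spread A \<le> (\<Sum>a\<in>(UNIV::'k set). \<Sum>b\<in>(UNIV::'k set). 2)"
    unfolding col_spread_def by (intro sum_mono)
  then show ?thesis by (simp add: power2_eq_square)
qed

text \<open>The l1 distance, twice total variation, is subadditive over the factors of product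
  measures: one coordinate at a time is exchanged, and the remaining coordinates contribute total
  mass 1.\<close>

lemma sum_abs_prod_diff_le:
  fixes p q :: "'i \<Rightarrow> 'a::finite \<Rightarrow> real"
  assumes "finite I"
    and "\<And>i a. i \<in> I \<Longrightarrow> 0 \<le> p i a" "\<And>i a. i \<in> I \<Longrightarrow> 0 \<le> q i a"
    and "\<And>i. i \<in> I \<Longrightarrow> (\<Sum>a\<in>UNIV. p i a) = 1" "\<And>i. i \<in> I \<Longrightarrow> (\<Sum>a\<in>UNIV. q i a) = 1"
  shows "(\<Sum>y\<in>I \<rightarrow>\<^sub>E UNIV. \<bar>(\<Prod>i\<in>I. p i (y i)) - (\<Prod>i\<in>I. q i (y i))\<bar>)
    \<le> (\<Sum>i\<in>I. \<Sum>a\<in>UNIV. \<bar>p i a - q i a\<bar>)"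
  using assms
proof (induction I rule: finite_induct)
  case empty
  then show ?case by simp
next
  case (insert x I)
  let ?E = "I \<rightarrow>\<^sub>E (UNIV :: 'a set)"
  let ?P = "\<lambda>g. \<Prod>i\<in>I. p i (g i)" and ?Q = "\<lambda>g. \<Prod>i\<in>I. q i (g i)"
  have upd: "(\<Prod>i\<in>insert x I. f i ((g(x := a)) i)) = f x a * (\<Prod>i\<in>I. f i (g i))"
    for f :: "'i \<Rightarrow> 'a \<Rightarrow> real" and g a
  proof -
    have "(\<Prod>i\<in>I. f i ((g(x := a)) i)) = (\<Prod>i\<in>I. f i (g i))"
      using insert by (intro prod.cong) auto
    then show ?thesis using insert by simp
  qed
  have P1: "(\<Sum>g\<in>?E. ?P g) = 1"
    using insert by (subst prod_sum_PiE[symmetric]) auto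
  have "(\<Sum>y\<in>insert x I \<rightarrow>\<^sub>E UNIV. \<bar>(\<Prod>i\<in>insert x I. p i (y i)) - (\<Prod>i\<in>insert x I. q i (y i))\<bar>)
      = (\<Sum>(a, g)\<in>UNIV \<times> ?E. \<bar>p x a * ?P g - q x a * ?Q g\<bar>)"
    unfolding PiE_insert_eq
    by (subst sum.reindex[OF inj_combinator[OF insert.hyps(2)]]) (simp only: o_def case_prod_unfold upd)
  also have "\<dots> = (\<Sum>a\<in>UNIV. \<Sum>g\<in>?E. \<bar>p x a * ?P g - q x a * ?Q g\<bar>)"
    by (rule sum.cartesian_product[symmetric])
  also have "\<dots> \<le> (\<Sum>a\<in>UNIV. \<Sum>g\<in>?E. \<bar>p x a - q x a\<bar> * ?P g + q x a * \<bar>?P g - ?Q g\<bar>)"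
  proof (intro sum_mono)
    fix a g
    \<comment> \<open>First coordinate \<open>x\<close> is exchanged while the others keep the law
      \<open>p\<close>; then the others are exchanged while \<open>x\<close> has the law
      \<open>q\<close>. The two weights left over, \<open>?P g\<close> and \<open>q x a\<close>,
      each sum to 1.\<close>
    have "p x a * ?P g - q x a * ?Q g = (p x a - q x a) * ?P g + q x a * (?P g - ?Q g)"
      by (simp add: algebra_simps)
    moreover have "0 \<le> ?P g" using insert by (intro prod_nonneg) auto
    moreover have "0 \<le> q x a" using insert by auto
    ultimately show "\<bar>p x a * ?P g - q x a * ?Q g\<bar> \<le> \<bar>p x a - q x a\<bar> * ?P g + q x a * \<bar>?P g - ?Q g\<bar>"
      using abs_triangle_ineq[of "(p x a - q x a) * ?P g" "q x a * (?P g - ?Q g)"]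
      by (simp add: abs_mult)
  qed
  also have "\<dots> = (\<Sum>a\<in>UNIV. \<bar>p x a - q x a\<bar>) * (\<Sum>g\<in>?E. ?P g)
      + (\<Sum>a\<in>UNIV. q x a) * (\<Sum>g\<in>?E. \<bar>?P g - ?Q g\<bar>)"
    by (simp add: sum.distrib sum_product)
  also have "\<dots> \<le> (\<Sum>a\<in>UNIV. \<bar>p x a - q x a\<bar>) + (\<Sum>i\<in>I. \<Sum>a\<in>UNIV. \<bar>p i a - q i a\<bar>)"
    using insert P1 by simp
  finally show ?case using insert by simp
qed

lemma sum_abs_prod_entries_diff_le:
  fixes A :: "real ^ 'k::finite ^ 'k"
  assumes A: "A \<in> col_stochastic"
  shows "(\<Sum>y\<in>states n. \<bar>(\<Prod>i\<in>{1..n}. A $ y i $ x i) - (\<Prod>i\<in>{1..n}. A $ y i $ x' i)\<bar>)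
    \<le> real n * real CARD('k) * col_spread A"
proof -
  have "(\<Sum>y\<in>states n. \<bar>(\<Prod>i\<in>{1..n}. A $ y i $ x i) - (\<Prod>i\<in>{1..n}. A $ y i $ x' i)\<bar>)
      \<le> (\<Sum>i\<in>{1..n}. \<Sum>a\<in>UNIV. \<bar>A $ a $ x i - A $ a $ x' i\<bar>)"
    unfolding states_def
    by (rule sum_abs_prod_diff_le[where p = "\<lambda>i a. A $ a $ x i" and q = "\<lambda>i a. A $ a $ x' i"])
      (simp_all add: A col_stochastic_nonneg col_stochastic_sum)
  also have "\<dots> \<le> (\<Sum>i\<in>{1..n}. \<Sum>a\<in>(UNIV::'k set). col_spread A)"
  proof (intro sum_mono)
    fix i a
    have "\<bar>A $ a $ x i - A $ a $ x' i\<bar> \<le> norm (column (x i) A - column (x' i) A)"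
      using component_le_norm_cart[of "column (x i) A - column (x' i) A" a] by (simp add: column_def)
    then show "\<bar>A $ a $ x i - A $ a $ x' i\<bar> \<le> col_spread A"
      using norm_column_diff_le order_trans by blast
  qed
  finally show ?thesis by simp
qed

subsection \<open>Stationarity and total variation\<close>

lemma states_nonempty: "states n \<noteq> {}"
  by (simp add: states_def PiE_eq_empty_iff)

lemma pmf_bind_states:
  fixes \<mu> :: "(nat \<Rightarrow> 'k::finite) pmf"
  assumes "set_pmf \<mu> \<subseteq> states n"
  shows "pmf (bind_pmf \<mu> K) y = (\<Sum>x\<in>states n. pmf \<mu> x * pmf (K x) y)"
  unfolding pmf_bind
  by (subst integral_measure_pmf_real[OF finite_states, of \<mu> _ n])
    (use assms in \<open>auto simp: mult.commute\<close>)

lemma sum_pmf_states: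
  fixes \<mu> :: "(nat \<Rightarrow> 'k::finite) pmf"
  shows "set_pmf \<mu> \<subseteq> states n \<Longrightarrow> (\<Sum>x\<in>states n. pmf \<mu> x) = 1"
  by (rule sum_pmf_eq_1[OF finite_states])

lemma abs_pmf_diff_le_tv_dist:
  fixes \<mu> :: "(nat \<Rightarrow> 'k::finite) pmf"
  assumes "y \<in> states n"
  shows "\<bar>pmf \<mu> y - pmf \<nu> y\<bar> \<le> 2 * tv_dist n \<mu> \<nu>"
  using member_le_sum[of y "states n" "\<lambda>y. \<bar>pmf \<mu> y - pmf \<nu> y\<bar>"] assms
  by (simp add: tv_dist_def finite_states)

text \<open>Both initial laws have total mass 1, so the difference of the two mixtures is the
  average of \<open>K x - K x'\<close> with \<open>x\<close> and \<open>x'\<close> drawn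
  independently from \<open>\<mu>\<close> and \<open>\<nu>\<close>. Its distance is then at most the
  average of the pairwise distances.\<close>

lemma tv_dist_bind_le:
  fixes \<mu> \<nu> :: "(nat \<Rightarrow> 'k::finite) pmf" and K :: "(nat \<Rightarrow> 'k) \<Rightarrow> (nat \<Rightarrow> 'k) pmf"
  assumes \<mu>: "set_pmf \<mu> \<subseteq> states n" and \<nu>: "set_pmf \<nu> \<subseteq> states n"
    and K: "\<And>x x'. x \<in> states n \<Longrightarrow> x' \<in> states n \<Longrightarrow> tv_dist n (K x) (K x') \<le> d"
  shows "tv_dist n (bind_pmf \<mu> K) (bind_pmf \<nu> K) \<le> d"
proof -
  let ?X = "states n :: (nat \<Rightarrow> 'k) set"
  have diff: "pmf (bind_pmf \<mu> K) y - pmf (bind_pmf \<nu> K) y =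
      (\<Sum>x\<in>?X. \<Sum>x'\<in>?X. pmf \<mu> x * pmf \<nu> x' * (pmf (K x) y - pmf (K x') y))" for y
  proof -
    have "(\<Sum>x\<in>?X. \<Sum>x'\<in>?X. pmf \<mu> x * pmf \<nu> x' * (pmf (K x) y - pmf (K x') y)) =
       (\<Sum>x\<in>?X. \<Sum>x'\<in>?X. (pmf \<mu> x * pmf (K x) y) * pmf \<nu> x')
       - (\<Sum>x\<in>?X. \<Sum>x'\<in>?X. pmf \<mu> x * (pmf \<nu> x' * pmf (K x') y))"
      unfolding sum_subtractf[symmetric] by (intro sum.cong) (simp_all add: algebra_simps)
    also have "\<dots> = (\<Sum>x\<in>?X. pmf \<mu> x * pmf (K x) y) - (\<Sum>x\<in>?X. pmf \<nu> x * pmf (K x) y)"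
      by (simp only: sum_distrib_left[symmetric] sum_distrib_right[symmetric]
          sum_pmf_states[OF \<mu>] sum_pmf_states[OF \<nu>] mult_1_left mult_1_right)
    finally show ?thesis by (simp add: pmf_bind_states[OF \<mu>] pmf_bind_states[OF \<nu>])
  qed
  have "tv_dist n (bind_pmf \<mu> K) (bind_pmf \<nu> K) \<le>
      (1 / 2) * (\<Sum>y\<in>?X. \<Sum>x\<in>?X. \<Sum>x'\<in>?X. pmf \<mu> x * pmf \<nu> x' * \<bar>pmf (K x) y - pmf (K x') y\<bar>)"
    unfolding tv_dist_def diff
  proof (intro mult_left_mono sum_mono order_trans[OF sum_abs])
    fix x x' y
    show "\<bar>pmf \<mu> x * pmf \<nu> x' * (pmf (K x) y - pmf (K x') y)\<bar> \<le>
        pmf \<mu> x * pmf \<nu> x' * \<bar>pmf (K x) y - pmf (K x') y\<bar>"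
      by (simp add: abs_mult)
  qed simp
  \<comment> \<open>The sum over \<open>y\<close> is moved innermost, where with the factor 1/2 it
    becomes \<open>tv_dist n (K x) (K x')\<close>.\<close>
  also have "(\<Sum>y\<in>?X. \<Sum>x\<in>?X. \<Sum>x'\<in>?X. pmf \<mu> x * pmf \<nu> x' * \<bar>pmf (K x) y - pmf (K x') y\<bar>)
      = (\<Sum>x\<in>?X. \<Sum>y\<in>?X. \<Sum>x'\<in>?X. pmf \<mu> x * pmf \<nu> x' * \<bar>pmf (K x) y - pmf (K x') y\<bar>)"
    by (rule sum.swap)
  also have "\<dots> = (\<Sum>x\<in>?X. \<Sum>x'\<in>?X. \<Sum>y\<in>?X. pmf \<mu> x * pmf \<nu> x' * \<bar>pmf (K x) y - pmf (K x') y\<bar>)"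
    by (intro sum.cong refl sum.swap)
  also have "(1 / 2) * \<dots> = (\<Sum>x\<in>?X. \<Sum>x'\<in>?X. pmf \<mu> x * pmf \<nu> x' * tv_dist n (K x) (K x'))"
    by (simp add: tv_dist_def sum_distrib_left mult_ac)
  also have "\<dots> \<le> (\<Sum>x\<in>?X. \<Sum>x'\<in>?X. pmf \<mu> x * pmf \<nu> x' * d)"
    by (intro sum_mono mult_left_mono K) auto
  also have "\<dots> = d"
    by (simp only: sum_distrib_left[symmetric] sum_distrib_right[symmetric]
          sum_pmf_states[OF \<mu>] sum_pmf_states[OF \<nu>] mult_1_left mult_1_right)
  finally show ?thesis .
qed

lemma set_pmf_efcp_step: "paintbox_measure \<Sigma> \<Longrightarrow> set_pmf (efcp_step \<Sigma> n x) \<subseteq> states n"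
  by (auto simp: set_pmf_eq pmf_efcp_step)

lemma set_pmf_efcp_law:
  assumes "paintbox_measure \<Sigma>" "x \<in> states n"
  shows "set_pmf (efcp_law \<Sigma> n x m) \<subseteq> states n"
  using assms(2) set_pmf_efcp_step[OF assms(1)] by (cases m) auto

text \<open>Chapman-Kolmogorov, with the last \<open>m\<close> steps written as a kernel so that
  \<open>tv_dist_bind_le\<close> can compare different random starting points.\<close>

lemma efcp_law_add:
  "efcp_law \<Sigma> n x (m + l) = bind_pmf (efcp_law \<Sigma> n x l) (\<lambda>z. efcp_law \<Sigma> n z m)"
  by (induction m) (simp_all add: bind_return_pmf' bind_assoc_pmf)

lemma efcp_stationary_law:
  assumes "efcp_stationary \<Sigma> n \<pi>"
  shows "bind_pmf \<pi> (\<lambda>x. efcp_law \<Sigma> n x m) = \<pi>"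
  using assms
  by (induction m)
    (simp_all add: bind_return_pmf' bind_assoc_pmf[symmetric] efcp_stationary_def)

text \<open>\<open>efcp_pi\<close> is a definite description, so existence and uniqueness are both
  required. The laws from a fixed start form a Cauchy sequence, as \<open>m + l\<close> steps are
  \<open>m\<close> steps from a random point; their limit is stationary. Two stationary laws are
  unchanged by \<open>m\<close> steps, hence within \<open>d m\<close> of each other for every
  \<open>m\<close>.\<close>

lemma efcp_pi_stationary:
  fixes \<Sigma> :: "(real ^ 'k::finite ^ 'k) measure"
  assumes \<Sigma>: "paintbox_measure \<Sigma>"
    and tv: "\<And>m x x'. x \<in> states n \<Longrightarrow> x' \<in> states n \<Longrightarrow>
      tv_dist n (efcp_law \<Sigma> n x m) (efcp_law \<Sigma> n x' m) \<le> d m"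
    and d: "d \<longlonglongrightarrow> 0"
  shows "efcp_stationary \<Sigma> n (efcp_pi \<Sigma> n)"
proof -
  obtain x0 :: "nat \<Rightarrow> 'k" where x0: "x0 \<in> states n" using states_nonempty by blast
  let ?f = "\<lambda>m. pmf (efcp_law \<Sigma> n x0 m)"
  note law = set_pmf_efcp_law[OF \<Sigma> x0]
  have diff: "\<bar>?f (m + l) y - ?f m y\<bar> \<le> 2 * d m" if "y \<in> states n" for m l y
  proof -
    have "tv_dist n (bind_pmf (efcp_law \<Sigma> n x0 l) (\<lambda>z. efcp_law \<Sigma> n z m))
        (bind_pmf (return_pmf x0) (\<lambda>z. efcp_law \<Sigma> n z m)) \<le> d m"
      using law x0 by (intro tv_dist_bind_le tv) auto
    then show ?thesis
      using abs_pmf_diff_le_tv_dist[OF that, of "efcp_law \<Sigma> n x0 (m + l)" "efcp_law \<Sigma> n x0 m"]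
      by (simp add: efcp_law_add bind_return_pmf)
  qed
  have "convergent (\<lambda>m. ?f m y)" for y
  proof (cases "y \<in> states n")
    case True
    have "Cauchy (\<lambda>m. ?f m y)"
    proof (rule CauchyI')
      fix e :: real assume "0 < e"
      then have "\<forall>\<^sub>F m in sequentially. d m < e / 2" by (intro order_tendstoD(2)[OF d]) simp
      then obtain N where N: "\<And>m. N \<le> m \<Longrightarrow> d m < e / 2" by (auto simp: eventually_sequentially)
      show "\<exists>N. \<forall>m\<ge>N. \<forall>l>m. dist (?f m y) (?f l y) < e"
      proof (intro exI allI impI)
        fix m l assume "N \<le> m" "m < l"
        then show "dist (?f m y) (?f l y) < e"
          using diff[OF True, of m "l - m"] N[of m] by (simp add: dist_real_def abs_minus_commute)
      qed
    qed
    then show ?thesis by (rule Cauchy_convergent)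
  next
    case False
    then have "?f m y = 0" for m using law[of m] by (auto simp: set_pmf_eq)
    then show ?thesis by (simp add: convergent_const)
  qed
  then obtain g where g: "\<And>y. (\<lambda>m. ?f m y) \<longlonglongrightarrow> g y"
    unfolding convergent_def by metis
  have g0: "0 \<le> g y" for y
    by (rule LIMSEQ_le_const[OF g]) auto
  have g_out: "g y = 0" if "y \<notin> states n" for y
  proof -
    have "?f m y = 0" for m using law[of m] that by (auto simp: set_pmf_eq)
    then show ?thesis using g[of y] by (simp add: LIMSEQ_const_iff)
  qed
  \<comment> \<open>The state space is finite, so no mass is lost in the limit.\<close>
  have "(\<lambda>m. \<Sum>y\<in>states n. ?f m y) \<longlonglongrightarrow> (\<Sum>y\<in>states n. g y)"
    by (intro tendsto_sum g)
  then have g1: "(\<Sum>y\<in>states n. g y) = 1"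
    by (simp add: sum_pmf_states[OF law] LIMSEQ_const_iff)
  define \<pi> where "\<pi> = embed_pmf g"
  have "(\<integral>\<^sup>+ y. ennreal (g y) \<partial>count_space UNIV) = (\<Sum>y\<in>states n. ennreal (g y))"
    by (rule nn_integral_count_space'[OF finite_states]) (auto simp: g_out)
  also have "\<dots> = 1" by (simp add: g0 g1 sum_ennreal)
  finally have pmf: "pmf \<pi> = g" unfolding \<pi>_def by (intro ext pmf_embed_pmf g0)
  have set: "set_pmf \<pi> \<subseteq> states n" using g_out by (fastforce simp: set_pmf_eq pmf)
  have "bind_pmf \<pi> (efcp_step \<Sigma> n) = \<pi>"
  proof (rule pmf_eqI)
    fix y
    \<comment> \<open>The left side is the law after \<open>Suc m\<close> steps, which also tends to
      \<open>g\<close>; comparing the two limits gives stationarity.\<close>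
    have "(\<lambda>m. \<Sum>x\<in>states n. ?f m x * pmf (efcp_step \<Sigma> n x) y)
        \<longlonglongrightarrow> (\<Sum>x\<in>states n. g x * pmf (efcp_step \<Sigma> n x) y)"
      by (intro tendsto_intros g)
    then have "(\<lambda>m. ?f (Suc m) y) \<longlonglongrightarrow> pmf (bind_pmf \<pi> (efcp_step \<Sigma> n)) y"
      by (simp add: pmf_bind_states[OF law] pmf_bind_states[OF set] pmf)
    then show "pmf (bind_pmf \<pi> (efcp_step \<Sigma> n)) y = pmf \<pi> y"
      using LIMSEQ_Suc[OF g] LIMSEQ_unique pmf by metis
  qed
  with set have stat: "efcp_stationary \<Sigma> n \<pi>" by (simp add: efcp_stationary_def)
  have "\<rho> = \<pi>" if \<rho>: "efcp_stationary \<Sigma> n \<rho>" for \<rho>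
  proof (rule pmf_eqI)
    fix y
    show "pmf \<rho> y = pmf \<pi> y"
    proof (cases "y \<in> states n")
      case True
      have "\<bar>pmf \<rho> y - pmf \<pi> y\<bar> \<le> 2 * d m" for m
      proof -
        have "tv_dist n \<rho> \<pi> \<le> d m"
          using tv_dist_bind_le[of \<rho> n \<pi> "\<lambda>x. efcp_law \<Sigma> n x m" "d m"] tv \<rho> stat
          by (simp add: efcp_stationary_law) (simp add: efcp_stationary_def)
        then show ?thesis using abs_pmf_diff_le_tv_dist[OF True, of \<rho> \<pi>] by simp
      qed
      then have "\<bar>pmf \<rho> y - pmf \<pi> y\<bar> \<le> 2 * 0"
        by (intro LIMSEQ_le_const[OF tendsto_mult_left[OF d]]) auto
      then show ?thesis by simp
    next
      case False
      then have "y \<notin> set_pmf \<rho>" "y \<notin> set_pmf \<pi>"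
        using \<rho> stat by (auto simp: efcp_stationary_def)
      then show ?thesis by (simp add: set_pmf_eq)
    qed
  qed
  with stat show ?thesis unfolding efcp_pi_def by (rule theI[where P = "efcp_stationary \<Sigma> n"])
qed

text \<open>The stationary law is itself an \<open>m\<close>-step law, started from a random point,
  so the bound between deterministic starts carries over.\<close>

lemma tv_dist_efcp_pi_le:
  assumes \<Sigma>: "paintbox_measure \<Sigma>" and x: "x \<in> states n"
    and pi: "efcp_stationary \<Sigma> n (efcp_pi \<Sigma> n)"
    and tv: "\<And>x x'. x \<in> states n \<Longrightarrow> x' \<in> states n \<Longrightarrow>
      tv_dist n (efcp_law \<Sigma> n x m) (efcp_law \<Sigma> n x' m) \<le> d"
  shows "tv_dist n (efcp_law \<Sigma> n x m) (efcp_pi \<Sigma> n) \<le> d"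
proof -
  have "tv_dist n (bind_pmf (return_pmf x) (\<lambda>x. efcp_law \<Sigma> n x m))
      (bind_pmf (efcp_pi \<Sigma> n) (\<lambda>x. efcp_law \<Sigma> n x m)) \<le> d"
    using x pi by (intro tv_dist_bind_le tv) (auto simp: efcp_stationary_def)
  then show ?thesis by (simp add: bind_return_pmf efcp_stationary_law[OF pi])
qed

subsection \<open>Random matrix products\<close>

lemma measurable_paintbox_borel:
  "paintbox_measure \<Sigma> \<Longrightarrow> f \<in> borel_measurable borel \<Longrightarrow> f \<in> borel_measurable \<Sigma>"
  using measurable_cong_sets[of \<Sigma> "restrict_space borel col_stochastic" borel borel]
  by (auto simp: paintbox_measure_def intro: measurable_restrict_space1)

lemma measurable_into_paintbox:
  assumes "paintbox_measure \<Sigma>" "f \<in> borel_measurable N" "f \<in> space N \<rightarrow> col_stochastic"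
  shows "f \<in> measurable N \<Sigma>"
  using assms measurable_cong_sets[of N N \<Sigma> "restrict_space borel col_stochastic"]
  by (auto simp: paintbox_measure_def intro: measurable_restrict_space2)

lemma measurable_matrix_mult:
  fixes \<Sigma> :: "(real ^ 'k::finite ^ 'k) measure"
  assumes \<Sigma>: "paintbox_measure \<Sigma>"
  shows "(\<lambda>(A, B). A ** B) \<in> measurable (\<Sigma> \<Otimes>\<^sub>M \<Sigma>) \<Sigma>"
proof (rule measurable_into_paintbox[OF \<Sigma>])
  have "continuous_on UNIV (\<lambda>(A, B). A ** B :: real ^ 'k ^ 'k)"
    unfolding matrix_matrix_mult_def case_prod_unfold
    by (intro continuous_on_vec_lambda continuous_intros)
  then have mult: "(\<lambda>(A, B). A ** B :: real ^ 'k ^ 'k) \<in> borel_measurable (borel \<Otimes>\<^sub>M borel)"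
    unfolding borel_prod by (rule borel_measurable_continuous_onI)
  have "(\<lambda>p. (fst p, snd p)) \<in> measurable (\<Sigma> \<Otimes>\<^sub>M \<Sigma>) (borel \<Otimes>\<^sub>M borel)"
    by (intro measurable_Pair measurable_compose[OF measurable_fst]
        measurable_compose[OF measurable_snd] measurable_paintbox_borel[OF \<Sigma>] measurable_ident_sets refl)
  from measurable_compose[OF this mult]
  show "(\<lambda>(A, B). A ** B) \<in> borel_measurable (\<Sigma> \<Otimes>\<^sub>M \<Sigma>)"
    by (simp add: case_prod_unfold)
qed (auto simp: space_pair_measure space_paintbox[OF \<Sigma>] col_stochastic_mult)

lemma borel_measurable_col_spread: "col_spread \<in> borel_measurable borel"
  unfolding col_spread_def[abs_def] column_def
  by (intro borel_measurable_continuous_onI continuous_intros continuous_on_vec_lambda)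

lemma borel_measurable_prod_entries:
  fixes x y :: "nat \<Rightarrow> 'k::finite"
  shows "(\<lambda>A :: real ^ 'k ^ 'k. \<Prod>i\<in>I. A $ y i $ x i) \<in> borel_measurable borel"
  by (intro borel_measurable_continuous_onI continuous_intros)

text \<open>Used to replace the family by its restriction to \<open>{1..m}\<close> when independence
  of blocks is invoked.\<close>

lemma left_prod_cong:
  "(\<And>i. 1 \<le> i \<Longrightarrow> i \<le> m \<Longrightarrow> f i = g i) \<Longrightarrow> left_prod f m = left_prod g m"
  by (induction m) auto

lemma measurable_left_prod:
  fixes \<Sigma> :: "(real ^ 'k::finite ^ 'k) measure"
  assumes \<Sigma>: "paintbox_measure \<Sigma>"
    and f: "\<And>i. 1 \<le> i \<Longrightarrow> i \<le> m \<Longrightarrow> f i \<in> measurable N \<Sigma>"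
  shows "(\<lambda>x. left_prod (\<lambda>i. f i x) m) \<in> measurable N \<Sigma>"
  using f
proof (induction m)
  case 0
  then show ?case by (simp add: space_paintbox[OF \<Sigma>] col_stochastic_mat_1)
next
  case (Suc m)
  have "(\<lambda>x. (f (Suc m) x, left_prod (\<lambda>i. f i x) m)) \<in> measurable N (\<Sigma> \<Otimes>\<^sub>M \<Sigma>)"
    using Suc by (intro measurable_Pair) auto
  from measurable_compose[OF this measurable_matrix_mult[OF \<Sigma>]] show ?case by simp
qed

text \<open>The transition operator of the matrix-valued Markov chain \<open>m \<mapsto> Q\<^sub>m\<close>.\<close>

definition avg_mult ::
    "(real ^ 'k::finite ^ 'k) measure \<Rightarrow> (real ^ 'k ^ 'k \<Rightarrow> ennreal) \<Rightarrow> real ^ 'k ^ 'k \<Rightarrow> ennreal"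
  where "avg_mult \<Sigma> F B = (\<integral>\<^sup>+ A. F (A ** B) \<partial>\<Sigma>)"

lemma measurable_avg_mult:
  assumes \<Sigma>: "paintbox_measure \<Sigma>" and F: "F \<in> borel_measurable \<Sigma>"
  shows "avg_mult \<Sigma> F \<in> borel_measurable \<Sigma>"
proof -
  interpret prob_space \<Sigma> using \<Sigma> by (simp add: paintbox_measure_def)
  have "(\<lambda>p. F (snd p ** fst p)) \<in> borel_measurable (\<Sigma> \<Otimes>\<^sub>M \<Sigma>)"
    using measurable_compose[OF measurable_pair_swap'
        measurable_compose[OF measurable_matrix_mult[OF \<Sigma>] F]]
    by (simp add: case_prod_unfold)
  then show ?thesis
    unfolding avg_mult_def[abs_def]
    by (intro borel_measurable_nn_integral) (simp add: case_prod_unfold)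
qed

lemma measurable_avg_mult_funpow:
  "paintbox_measure \<Sigma> \<Longrightarrow> F \<in> borel_measurable \<Sigma> \<Longrightarrow> (avg_mult \<Sigma> ^^ m) F \<in> borel_measurable \<Sigma>"
  by (induction m) (auto intro: measurable_avg_mult)

text \<open>New factors enter on the left, so \<open>B\<close> stays rightmost and its spread can be
  pulled out of every average. The induction needs an arbitrary \<open>A\<close>; the application
  takes \<open>A = mat 1\<close> and \<open>B = Q l \<omega>\<close>.\<close>

lemma avg_mult_funpow_col_spread:
  assumes \<Sigma>: "paintbox_measure \<Sigma>" and "A \<in> col_stochastic" "B \<in> col_stochastic"
  shows "(avg_mult \<Sigma> ^^ m) (\<lambda>A. ennreal (col_spread A)) (A ** B)
    \<le> ennreal (col_spread B) * (avg_mult \<Sigma> ^^ m) (\<lambda>A. ennreal (col_spread A)) A"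
  using assms(2)
proof (induction m arbitrary: A)
  case 0
  show ?case using col_spread_mult[OF assms(3), of A]
    by (simp add: ennreal_mult'[symmetric] col_spread_nonneg mult.commute)
next
  case (Suc m)
  let ?F = "(avg_mult \<Sigma> ^^ m) (\<lambda>A. ennreal (col_spread A))"
  have "(\<lambda>C. (C, A)) \<in> measurable \<Sigma> (\<Sigma> \<Otimes>\<^sub>M \<Sigma>)"
    using Suc.prems by (intro measurable_Pair) (auto simp: space_paintbox[OF \<Sigma>])
  from measurable_compose[OF this measurable_matrix_mult[OF \<Sigma>]]
  have CA: "(\<lambda>C. C ** A) \<in> measurable \<Sigma> \<Sigma>" by simp
  have "?F \<in> borel_measurable \<Sigma>"
    by (intro measurable_avg_mult_funpow \<Sigma> measurable_compose[OF _ measurable_ennreal]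
        measurable_paintbox_borel[OF \<Sigma>] borel_measurable_col_spread)
  then have FA: "(\<lambda>C. ?F (C ** A)) \<in> borel_measurable \<Sigma>"
    by (rule measurable_compose[OF CA])
  have "(avg_mult \<Sigma> ^^ Suc m) (\<lambda>A. ennreal (col_spread A)) (A ** B) = (\<integral>\<^sup>+ C. ?F ((C ** A) ** B) \<partial>\<Sigma>)"
    by (simp add: avg_mult_def matrix_mul_assoc)
  also have "\<dots> \<le> (\<integral>\<^sup>+ C. ennreal (col_spread B) * ?F (C ** A) \<partial>\<Sigma>)"
    using Suc by (intro nn_integral_mono Suc.IH) (auto simp: space_paintbox[OF \<Sigma>] col_stochastic_mult)
  also have "\<dots> = ennreal (col_spread B) * (\<integral>\<^sup>+ C. ?F (C ** A) \<partial>\<Sigma>)"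
    by (rule nn_integral_cmult[OF FA])
  finally show ?case by (simp add: avg_mult_def[of \<Sigma> ?F])
qed

section \<open>Products of an i.i.d. sequence of random matrices\<close>

locale iid_paintbox = prob_space M for M :: "'w measure" +
  fixes \<Sigma> :: "(real ^ 'k::finite ^ 'k) measure" and S :: "nat \<Rightarrow> 'w \<Rightarrow> real ^ 'k ^ 'k"
  assumes paintbox: "paintbox_measure \<Sigma>"
    and indep: "indep_vars (\<lambda>_. \<Sigma>) S {1..}"
    and law: "\<And>m. 1 \<le> m \<Longrightarrow> distr M \<Sigma> (S m) = \<Sigma>"
begin

definition Q :: "nat \<Rightarrow> 'w \<Rightarrow> real ^ 'k ^ 'k" where
  "Q m \<omega> = left_prod (\<lambda>i. S i \<omega>) m"

lemma measurable_S: "1 \<le> i \<Longrightarrow> S i \<in> measurable M \<Sigma>"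
  using indep by (auto simp: indep_vars_def2)

lemma measurable_Q: "Q m \<in> measurable M \<Sigma>"
  unfolding Q_def[abs_def] by (intro measurable_left_prod paintbox measurable_S)

lemma Q_col_stochastic: "\<omega> \<in> space M \<Longrightarrow> Q m \<omega> \<in> col_stochastic"
  using measurable_space[OF measurable_Q] by (simp add: space_paintbox[OF paintbox])

text \<open>\<open>Q m\<close> is a measurable function of the block with indices
  \<open>{1..m}\<close>, which is disjoint from \<open>{Suc m}\<close>.\<close>

lemma indep_S_Q: "indep_var \<Sigma> (S (Suc m)) \<Sigma> (Q m)"
proof -
  let ?r = "\<lambda>A \<omega>. restrict (\<lambda>i. S i \<omega>) A"
  have "indep_var (PiM {Suc m} (\<lambda>_. \<Sigma>)) (?r {Suc m}) (PiM {1..m} (\<lambda>_. \<Sigma>)) (?r {1..m})"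
    by (rule indep_var_restrict[OF indep]) auto
  then have "indep_var \<Sigma> ((\<lambda>f. f (Suc m)) \<circ> ?r {Suc m}) \<Sigma> ((\<lambda>f. left_prod f m) \<circ> ?r {1..m})"
  proof (rule indep_var_compose)
    show "(\<lambda>f. f (Suc m)) \<in> measurable (PiM {Suc m} (\<lambda>_. \<Sigma>)) \<Sigma>"
      by (rule measurable_component_singleton) simp
    show "(\<lambda>f. left_prod f m) \<in> measurable (PiM {1..m} (\<lambda>_. \<Sigma>)) \<Sigma>"
      by (rule measurable_left_prod[OF paintbox, where f = "\<lambda>i f. f i"])
        (rule measurable_component_singleton, simp)
  qed
  moreover have "(\<lambda>f. left_prod f m) \<circ> ?r {1..m} = Q m"
    by (auto simp: Q_def fun_eq_iff intro!: left_prod_cong)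
  moreover have "(\<lambda>f. f (Suc m)) \<circ> ?r {Suc m} = S (Suc m)"
    by (simp add: fun_eq_iff)
  ultimately show ?thesis by simp
qed

lemma nn_integral_Q_Suc:
  assumes F: "F \<in> borel_measurable \<Sigma>"
  shows "(\<integral>\<^sup>+ \<omega>. F (Q (Suc m) \<omega>) \<partial>M) = (\<integral>\<^sup>+ \<omega>. avg_mult \<Sigma> F (Q m \<omega>) \<partial>M)"
proof -
  let ?\<nu> = "distr M \<Sigma> (Q m)"
  interpret \<Sigma>: prob_space \<Sigma> using paintbox by (simp add: paintbox_measure_def)
  interpret \<nu>: prob_space ?\<nu> by (rule prob_space_distr[OF measurable_Q])
  interpret P: pair_sigma_finite \<Sigma> ?\<nu> ..
  \<comment> \<open>Independence makes the joint law a product, so Fubini can integrate out the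
    newest factor while \<open>Q m\<close> is held fixed.\<close>
  have joint: "\<Sigma> \<Otimes>\<^sub>M ?\<nu> = distr M (\<Sigma> \<Otimes>\<^sub>M \<Sigma>) (\<lambda>\<omega>. (S (Suc m) \<omega>, Q m \<omega>))"
    using indep_S_Q[of m] law[of "Suc m"] unfolding indep_var_distribution_eq by simp
  have F': "(\<lambda>p. F (fst p ** snd p)) \<in> borel_measurable (\<Sigma> \<Otimes>\<^sub>M \<Sigma>)"
    using measurable_compose[OF measurable_matrix_mult[OF paintbox] F] by (simp add: case_prod_unfold)
  have sets: "sets (\<Sigma> \<Otimes>\<^sub>M ?\<nu>) = sets (\<Sigma> \<Otimes>\<^sub>M \<Sigma>)"
    by (intro sets_pair_measure_cong) auto
  have F'': "(\<lambda>p. F (fst p ** snd p)) \<in> borel_measurable (\<Sigma> \<Otimes>\<^sub>M ?\<nu>)"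
    using F' measurable_cong_sets[OF sets refl] by blast
  have "(\<integral>\<^sup>+ \<omega>. F (Q (Suc m) \<omega>) \<partial>M) = (\<integral>\<^sup>+ \<omega>. F (S (Suc m) \<omega> ** Q m \<omega>) \<partial>M)"
    by (simp add: Q_def)
  also have "\<dots> = (\<integral>\<^sup>+ p. F (fst p ** snd p) \<partial>(\<Sigma> \<Otimes>\<^sub>M ?\<nu>))"
    unfolding joint
    by (subst nn_integral_distr) (auto intro!: measurable_Pair measurable_S measurable_Q F')
  also have "\<dots> = (\<integral>\<^sup>+ B. avg_mult \<Sigma> F B \<partial>?\<nu>)"
    unfolding avg_mult_def P.nn_integral_snd[OF F'', symmetric] by simp
  also have "\<dots> = (\<integral>\<^sup>+ \<omega>. avg_mult \<Sigma> F (Q m \<omega>) \<partial>M)"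
    by (rule nn_integral_distr[OF measurable_Q]) (simp add: measurable_avg_mult[OF paintbox F])
  finally show ?thesis .
qed

text \<open>The newest factor is averaged out first, which changes the integrand; hence
  \<open>F\<close> varies in the induction, which ends at \<open>Q 0\<close>, the identity.\<close>

lemma nn_integral_Q:
  assumes "F \<in> borel_measurable \<Sigma>"
  shows "(\<integral>\<^sup>+ \<omega>. F (Q m \<omega>) \<partial>M) = (avg_mult \<Sigma> ^^ m) F (mat 1)"
  using assms
proof (induction m arbitrary: F)
  case 0
  then show ?case by (simp add: Q_def emeasure_space_1)
next
  case (Suc m)
  then show ?case
    by (simp add: nn_integral_Q_Suc measurable_avg_mult[OF paintbox] funpow_Suc_right
        del: funpow.simps)
qed

lemma measurable_col_spread: "(\<lambda>A. ennreal (col_spread A)) \<in> borel_measurable \<Sigma>"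
  by (intro measurable_compose[OF _ measurable_ennreal] measurable_paintbox_borel[OF paintbox]
      borel_measurable_col_spread)

section \<open>Exponential decay of the expected spread\<close>

definition spread :: "nat \<Rightarrow> real" where
  "spread m = expectation (\<lambda>\<omega>. col_spread (Q m \<omega>))"

lemma integrable_col_spread: "integrable M (\<lambda>\<omega>. col_spread (Q m \<omega>))"
proof (rule integrable_const_bound)
  show "AE \<omega> in M. norm (col_spread (Q m \<omega>)) \<le> 2 * (real CARD('k))\<^sup>2"
    by (rule AE_I2) (simp add: col_spread_nonneg col_spread_le Q_col_stochastic)
qed (rule measurable_compose[OF measurable_Q measurable_paintbox_borel[OF paintbox
    borel_measurable_col_spread]])

lemma spread_nonneg: "0 \<le> spread m"
  by (simp add: spread_def col_spread_nonneg)

text \<open>Shows in particular that \<open>spread\<close> is determined by \<open>\<Sigma>\<close>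
  alone and not by the chosen realization of the matrices.\<close>

lemma ennreal_spread:
  "ennreal (spread m) = (avg_mult \<Sigma> ^^ m) (\<lambda>A. ennreal (col_spread A)) (mat 1)"
  unfolding spread_def nn_integral_Q[OF measurable_col_spread, symmetric]
  by (rule nn_integral_eq_integral[OF integrable_col_spread, symmetric]) (simp add: col_spread_nonneg)

lemma spread_add_le: "spread (m + l) \<le> spread m * spread l"
proof -
  let ?C = "\<lambda>A. ennreal (col_spread A)"
  let ?T = "\<lambda>m. (avg_mult \<Sigma> ^^ m) ?C"
  \<comment> \<open>The \<open>m\<close> later factors are averaged first, leaving a function of
    \<open>Q l\<close>, from which \<open>col_spread (Q l \<omega>)\<close> is then split
    off.\<close>
  have "ennreal (spread (m + l)) = (avg_mult \<Sigma> ^^ l) (?T m) (mat 1)"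
    by (simp add: ennreal_spread add.commute[of m l] funpow_add)
  also have "\<dots> = (\<integral>\<^sup>+ \<omega>. ?T m (Q l \<omega>) \<partial>M)"
    by (rule nn_integral_Q[symmetric]) (intro measurable_avg_mult_funpow paintbox measurable_col_spread)
  also have "\<dots> \<le> (\<integral>\<^sup>+ \<omega>. ennreal (spread m) * ?C (Q l \<omega>) \<partial>M)"
  proof (rule nn_integral_mono)
    fix \<omega> assume "\<omega> \<in> space M"
    then show "?T m (Q l \<omega>) \<le> ennreal (spread m) * ?C (Q l \<omega>)"
      using avg_mult_funpow_col_spread[OF paintbox col_stochastic_mat_1 Q_col_stochastic, of \<omega> m l]
      by (simp add: ennreal_spread mult.commute)
  qed
  also have "\<dots> = ennreal (spread m) * (\<integral>\<^sup>+ \<omega>. ?C (Q l \<omega>) \<partial>M)"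
    by (intro nn_integral_cmult measurable_compose[OF measurable_Q measurable_col_spread])
  also have "\<dots> = ennreal (spread m * spread l)"
    by (simp add: nn_integral_Q[OF measurable_col_spread] ennreal_spread[symmetric] ennreal_mult spread_nonneg)
  finally show ?thesis by (simp add: spread_nonneg)
qed

text \<open>The exponent starts at 1 because \<open>spread 0\<close> is the spread of the identity
  matrix, which can exceed 1.\<close>

lemma spread_mult_le: "spread (m * Suc j) \<le> spread m ^ Suc j"
proof (induction j)
  case (Suc j)
  have "spread (m * Suc (Suc j)) \<le> spread m * spread (m * Suc j)"
    using spread_add_le[of m "m * Suc j"] by simp
  also have "\<dots> \<le> spread m * spread m ^ Suc j"
    by (rule mult_left_mono[OF Suc spread_nonneg])
  finally show ?case by simp
qed simp

lemma spread_tendsto_0: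
  assumes "AE \<omega> in M. collapses_simplex (\<lambda>m. S m \<omega>)"
  shows "spread \<longlonglongrightarrow> 0"
proof -
  have "(\<lambda>m. expectation (\<lambda>\<omega>. col_spread (Q m \<omega>))) \<longlonglongrightarrow> expectation (\<lambda>\<omega>. 0)"
  proof (rule integral_dominated_convergence)
    show "AE \<omega> in M. (\<lambda>m. col_spread (Q m \<omega>)) \<longlonglongrightarrow> 0"
      using assms AE_space
    proof eventually_elim
      case (elim \<omega>)
      let ?D = "\<lambda>m. (real CARD('k))\<^sup>2 * diameter ((\<lambda>v. Q m \<omega> *v v) ` prob_simplex)"
      have "?D \<longlonglongrightarrow> (real CARD('k))\<^sup>2 * 0"
        using elim by (intro tendsto_mult_left) (simp add: collapses_simplex_def Q_def)
      then have D: "?D \<longlonglongrightarrow> 0" by simp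
      show ?case
      proof (rule tendsto_sandwich[OF _ _ tendsto_const D])
        show "\<forall>\<^sub>F m in sequentially. 0 \<le> col_spread (Q m \<omega>)"
          by (simp add: col_spread_nonneg)
        show "\<forall>\<^sub>F m in sequentially. col_spread (Q m \<omega>) \<le> ?D m"
          using elim by (intro always_eventually allI col_spread_le_diameter Q_col_stochastic)
      qed
    qed
    show "AE \<omega> in M. norm (col_spread (Q m \<omega>)) \<le> 2 * (real CARD('k))\<^sup>2" for m
      by (rule AE_I2) (simp add: col_spread_nonneg col_spread_le Q_col_stochastic)
    show "(\<lambda>\<omega>. col_spread (Q m \<omega>)) \<in> borel_measurable M" for m
      using integrable_col_spread by (rule borel_measurable_integrable)
  qed auto
  then show ?thesis by (simp add: spread_def[abs_def])
qed

section \<open>The law of the chain in terms of the matrix products\<close>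

lemma avg_mult_prod_entries:
  fixes x y :: "nat \<Rightarrow> 'k"
  assumes B: "B \<in> col_stochastic"
  shows "avg_mult \<Sigma> (\<lambda>A. ennreal (\<Prod>i\<in>{1..n}. A $ y i $ x i)) B =
    (\<Sum>z\<in>states n. ennreal (\<Prod>i\<in>{1..n}. B $ z i $ x i) * ennreal (efcp_prob \<Sigma> n z y))"
proof -
  have "avg_mult \<Sigma> (\<lambda>A. ennreal (\<Prod>i\<in>{1..n}. A $ y i $ x i)) B =
      (\<integral>\<^sup>+ A. (\<Sum>z\<in>states n. ennreal (\<Prod>i\<in>{1..n}. B $ z i $ x i) * ennreal (\<Prod>i\<in>{1..n}. A $ y i $ z i)) \<partial>\<Sigma>)"
    unfolding avg_mult_def
  proof (rule nn_integral_cong)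
    fix A assume "A \<in> space \<Sigma>"
    then have A: "A \<in> col_stochastic" by (simp add: space_paintbox[OF paintbox])
    have "(\<Prod>i\<in>{1..n}. (A ** B) $ y i $ x i) = (\<Prod>i\<in>{1..n}. \<Sum>c\<in>UNIV. B $ c $ x i * A $ y i $ c)"
      by (simp add: matrix_matrix_mult_def mult.commute)
    \<comment> \<open>Choosing an intermediate letter for each coordinate amounts to choosing an
      intermediate state \<open>z\<close>. Averaging over \<open>A\<close> afterwards produces the
      transition probability from \<open>z\<close> to \<open>y\<close>.\<close>
    also have "\<dots> = (\<Sum>z\<in>states n. \<Prod>i\<in>{1..n}. B $ z i $ x i * A $ y i $ z i)"
      unfolding states_def by (rule prod_sum_PiE) auto
    finally show "ennreal (\<Prod>i\<in>{1..n}. (A ** B) $ y i $ x i) =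
        (\<Sum>z\<in>states n. ennreal (\<Prod>i\<in>{1..n}. B $ z i $ x i) * ennreal (\<Prod>i\<in>{1..n}. A $ y i $ z i))"
      using A B
      by (simp add: prod.distrib ennreal_mult[symmetric] prod_nonneg col_stochastic_nonneg sum_ennreal)
  qed
  also have "\<dots> = (\<Sum>z\<in>states n. ennreal (\<Prod>i\<in>{1..n}. B $ z i $ x i) *
      (\<integral>\<^sup>+ A. ennreal (\<Prod>i\<in>{1..n}. A $ y i $ z i) \<partial>\<Sigma>))"
    by (subst nn_integral_sum)
      (auto intro!: sum.cong nn_integral_cmult borel_measurable_times_ennreal
        measurable_compose[OF _ measurable_ennreal] measurable_paintbox_borel[OF paintbox]
        borel_measurable_prod_entries)
  also have "\<dots> = (\<Sum>z\<in>states n. ennreal (\<Prod>i\<in>{1..n}. B $ z i $ x i) * ennreal (efcp_prob \<Sigma> n z y))"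
    unfolding efcp_prob_def
    by (intro sum.cong refl arg_cong2[where f = "(*)"] nn_integral_eq_integral efcp_integrable paintbox AE_I2)
      (auto simp: space_paintbox[OF paintbox] intro!: prod_nonneg col_stochastic_nonneg)
  finally show ?thesis .
qed

lemma pmf_efcp_law_nn_integral:
  assumes x: "x \<in> states n" and y: "y \<in> states n"
  shows "ennreal (pmf (efcp_law \<Sigma> n x m) y) = (\<integral>\<^sup>+ \<omega>. ennreal (\<Prod>i\<in>{1..n}. Q m \<omega> $ y i $ x i) \<partial>M)"
  using y
proof (induction m arbitrary: y)
  case 0
  have "(\<Prod>i\<in>{1..n}. mat 1 $ y i $ x i) = (if x = y then 1 else (0::real))"
  proof (cases "x = y")
    case False
    \<comment> \<open>Both states are extensional on \<open>{1..n}\<close>, so they differ at a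
      coordinate inside this range, where the identity matrix contributes a factor 0.\<close>
    then obtain i where "i \<in> {1..n}" "x i \<noteq> y i"
      using x 0 unfolding states_def by (metis PiE_ext)
    then have "\<exists>i\<in>{1..n}. mat 1 $ y i $ x i = (0::real)"
      by (auto simp: mat_def intro!: bexI[of _ i])
    then show ?thesis using False by (simp add: prod_zero)
  qed (simp add: mat_def)
  then show ?case
    by (simp add: Q_def emeasure_space_1 indicator_def)
next
  case (Suc m)
  let ?p = "\<lambda>y A. \<Prod>i\<in>{1..n}. A $ y i $ x i"
  have meas: "(\<lambda>A. ennreal (?p y A)) \<in> borel_measurable \<Sigma>" for y
    by (intro measurable_compose[OF _ measurable_ennreal] measurable_paintbox_borel[OF paintbox]
        borel_measurable_prod_entries)
  have "ennreal (pmf (efcp_law \<Sigma> n x (Suc m)) y) =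
      ennreal (\<Sum>z\<in>states n. pmf (efcp_law \<Sigma> n x m) z * efcp_prob \<Sigma> n z y)"
    using Suc.prems
    by (simp add: pmf_bind_states[OF set_pmf_efcp_law[OF paintbox x]] pmf_efcp_step[OF paintbox])
  also have "\<dots> = (\<Sum>z\<in>states n. (\<integral>\<^sup>+ \<omega>. ennreal (?p z (Q m \<omega>)) \<partial>M) * ennreal (efcp_prob \<Sigma> n z y))"
    using Suc.IH
    by (simp only: sum_ennreal[symmetric] ennreal_mult efcp_prob_nonneg[OF paintbox] pmf_nonneg
        mult_nonneg_nonneg cong: sum.cong)
  also have "\<dots> = (\<integral>\<^sup>+ \<omega>. (\<Sum>z\<in>states n. ennreal (?p z (Q m \<omega>)) * ennreal (efcp_prob \<Sigma> n z y)) \<partial>M)"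
    by (subst nn_integral_sum)
      (auto intro!: sum.cong nn_integral_multc[symmetric] borel_measurable_times_ennreal
        measurable_compose[OF measurable_Q meas] simp del: One_nat_def)
  also have "\<dots> = (\<integral>\<^sup>+ \<omega>. avg_mult \<Sigma> (\<lambda>A. ennreal (?p y A)) (Q m \<omega>) \<partial>M)"
    by (intro nn_integral_cong) (simp only: avg_mult_prod_entries Q_col_stochastic)
  also have "\<dots> = (\<integral>\<^sup>+ \<omega>. ennreal (?p y (Q (Suc m) \<omega>)) \<partial>M)"
    by (rule nn_integral_Q_Suc[OF meas, symmetric])
  finally show ?case .
qed

lemma integrable_prod_entries:
  fixes x y :: "nat \<Rightarrow> 'k"
  shows "integrable M (\<lambda>\<omega>. \<Prod>i\<in>{1..n}. Q m \<omega> $ y i $ x i)"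
proof (rule integrable_const_bound)
  show "AE \<omega> in M. norm (\<Prod>i\<in>{1..n}. Q m \<omega> $ y i $ x i) \<le> 1"
    using Q_col_stochastic
    by (intro AE_I2) (auto simp: abs_prod col_stochastic_nonneg col_stochastic_le_1 intro!: prod_le_1)
qed (rule measurable_compose[OF measurable_Q measurable_paintbox_borel[OF paintbox
    borel_measurable_prod_entries]])

text \<open>The real-valued form, in which the laws from two starting points can be
  subtracted.\<close>

lemma pmf_efcp_law:
  assumes "x \<in> states n" "y \<in> states n"
  shows "pmf (efcp_law \<Sigma> n x m) y = expectation (\<lambda>\<omega>. \<Prod>i\<in>{1..n}. Q m \<omega> $ y i $ x i)"
proof -
  have nonneg: "0 \<le> (\<Prod>i\<in>{1..n}. Q m \<omega> $ y i $ x i)" if "\<omega> \<in> space M" for \<omega>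
    using Q_col_stochastic[OF that] by (auto intro!: prod_nonneg col_stochastic_nonneg)
  have "ennreal (pmf (efcp_law \<Sigma> n x m) y) = ennreal (expectation (\<lambda>\<omega>. \<Prod>i\<in>{1..n}. Q m \<omega> $ y i $ x i))"
    unfolding pmf_efcp_law_nn_integral[OF assms]
    by (rule nn_integral_eq_integral[OF integrable_prod_entries]) (rule AE_I2, rule nonneg)
  then show ?thesis
    by (subst (asm) ennreal_inj)
      (auto intro!: Bochner_Integration.integral_nonneg nonneg simp del: One_nat_def)
qed

text \<open>Both chains are represented with the same random matrix \<open>Q m\<close>. The absolute
  value moves inside the expectation, and the bound for a fixed matrix is then averaged.\<close>

lemma tv_dist_efcp_law_le:
  assumes x: "x \<in> states n" and x': "x' \<in> states n"
  shows "tv_dist n (efcp_law \<Sigma> n x m) (efcp_law \<Sigma> n x' m) \<le> real n * real CARD('k) * spread m"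
proof -
  let ?p = "\<lambda>x y \<omega>. \<Prod>i\<in>{1..n}. Q m \<omega> $ y i $ x i"
  have "(\<Sum>y\<in>states n. \<bar>pmf (efcp_law \<Sigma> n x m) y - pmf (efcp_law \<Sigma> n x' m) y\<bar>) =
      (\<Sum>y\<in>states n. \<bar>expectation (\<lambda>\<omega>. ?p x y \<omega> - ?p x' y \<omega>)\<bar>)"
    by (intro sum.cong refl) (simp only: pmf_efcp_law x x'
      Bochner_Integration.integral_diff[OF integrable_prod_entries integrable_prod_entries])
  also have "\<dots> \<le> (\<Sum>y\<in>states n. expectation (\<lambda>\<omega>. \<bar>?p x y \<omega> - ?p x' y \<omega>\<bar>))"
    by (intro sum_mono integral_abs_bound)
  also have "\<dots> = expectation (\<lambda>\<omega>. \<Sum>y\<in>states n. \<bar>?p x y \<omega> - ?p x' y \<omega>\<bar>)"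
    by (intro Bochner_Integration.integral_sum[symmetric] integrable_abs
        Bochner_Integration.integrable_diff integrable_prod_entries)
  also have "\<dots> \<le> expectation (\<lambda>\<omega>. real n * real CARD('k) * col_spread (Q m \<omega>))"
    by (intro integral_mono Bochner_Integration.integrable_sum integrable_abs integrable_mult_right
        Bochner_Integration.integrable_diff integrable_prod_entries integrable_col_spread
        sum_abs_prod_entries_diff_le Q_col_stochastic)
  also have "\<dots> = real n * real CARD('k) * spread m"
    by (simp add: spread_def)
  finally have "2 * tv_dist n (efcp_law \<Sigma> n x m) (efcp_law \<Sigma> n x' m) \<le> real n * real CARD('k) * spread m"
    by (simp add: tv_dist_def)
  moreover have "0 \<le> tv_dist n (efcp_law \<Sigma> n x m) (efcp_law \<Sigma> n x' m)"
    by (simp add: tv_dist_def sum_nonneg)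
  ultimately show ?thesis by linarith
qed

end

section \<open>The choice of \<open>K\<close> and of the number of steps\<close>

theorem theorem5p4:
  fixes \<Sigma> :: "(real ^ 'k::finite ^ 'k) measure"
    and M :: "'w measure"
    and S :: "nat \<Rightarrow> 'w \<Rightarrow> real ^ 'k ^ 'k"
  assumes paintbox: "paintbox_measure \<Sigma>"
    and prob: "prob_space M"
    and indep: "prob_space.indep_vars M (\<lambda>_. \<Sigma>) S {1..}"
    and law: "\<And>m. 1 \<le> m \<Longrightarrow> distr M \<Sigma> (S m) = \<Sigma>"
    and collapse: "AE \<omega> in M. collapses_simplex (\<lambda>m. S m \<omega>)"
  shows "\<exists>K::real. \<forall>\<epsilon>::real. 0 < \<epsilon> \<and> \<epsilon> < 1 \<longrightarrow>
           (\<forall>\<^sub>F n in sequentially. ereal_of_enat (efcp_tmix \<Sigma> n \<epsilon>) \<le> ereal (K * ln (real n)))"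
proof -
  interpret iid_paintbox M \<Sigma> S
    using assms by (simp add: iid_paintbox_def iid_paintbox_axioms_def)
  let ?k = "real CARD('k)"
  note spread0 = spread_tendsto_0[OF collapse]
  have pi: "efcp_stationary \<Sigma> n (efcp_pi \<Sigma> n)" for n
  proof (rule efcp_pi_stationary[OF paintbox tv_dist_efcp_law_le])
    show "(\<lambda>m. real n * ?k * spread m) \<longlonglongrightarrow> 0"
      using tendsto_mult_left[OF spread0, of "real n * ?k"] by simp
  qed
  \<comment> \<open>The block length \<open>m0\<close> is chosen before \<open>n\<close> and
    \<open>\<epsilon>\<close>. Requiring \<open>1 \<le> m0\<close> makes the final \<open>m\<close>
    admissible in \<open>efcp_tmix\<close>.\<close>
  have "\<forall>\<^sub>F m in sequentially. spread m < 1 / 2 \<and> 1 \<le> m"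
    by (intro eventually_conj order_tendstoD(2)[OF spread0] eventually_ge_at_top) simp
  then obtain m0 where m0: "spread m0 < 1 / 2" "1 \<le> m0"
    using eventually_happens'[OF sequentially_bot] by blast
  define K where "K = real m0 * (2 / ln 2 + 2)"
  show ?thesis
  proof (intro exI[of _ K] allI impI, elim conjE)
    fix \<epsilon> :: real assume "0 < \<epsilon>"
    \<comment> \<open>The final distance is at most \<open>?k / real n\<close>, so
      \<open>\<epsilon>\<close> affects only how large \<open>n\<close> must be and not
      \<open>K\<close>.\<close>
    have "(\<lambda>n. ?k / real n) \<longlonglongrightarrow> 0" by (rule lim_const_over_n)
    then have "\<forall>\<^sub>F n in sequentially. ?k / real n < \<epsilon>"
      using \<open>0 < \<epsilon>\<close> by (rule order_tendstoD(2))
    then show "\<forall>\<^sub>F n in sequentially. ereal_of_enat (efcp_tmix \<Sigma> n \<epsilon>) \<le> ereal (K * ln (real n))"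
      using eventually_ge_at_top[of 3]
    proof eventually_elim
      case (elim n)
      \<comment> \<open>Chosen so that \<open>2 ^ j\<close> is at least the square of
        \<open>n\<close>: one factor \<open>n\<close> cancels the \<open>n\<close> in the total
        variation bound, the other makes the bound tend to 0.\<close>
      define j where "j = nat \<lceil>2 * log 2 (real n)\<rceil>"
      define m where "m = m0 * Suc j"
      have n: "3 \<le> real n" using elim by simp
      have j: "2 * log 2 (real n) \<le> real j" "real j \<le> 2 * log 2 (real n) + 1"
        using n unfolding j_def by (auto intro: real_nat_ceiling_ge)
      have "real n ^ 2 = (2 powr log 2 (real n)) powr 2" using n by simp
      also have "\<dots> = 2 powr (2 * log 2 (real n))" by (simp only: powr_powr mult.commute)
      also have "\<dots> \<le> 2 powr real j" using j by simp
      also have "\<dots> \<le> 2 ^ Suc j" by (simp add: powr_realpow)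
      finally have n2: "real n ^ 2 \<le> 2 ^ Suc j" .
      have "spread m \<le> (1 / 2) ^ Suc j"
        unfolding m_def using m0 spread_mult_le[of m0 j] power_mono[of "spread m0" "1 / 2" "Suc j"]
        by (simp add: spread_nonneg)
      also have "\<dots> \<le> 1 / real n ^ 2"
        using n n2 by (simp add: power_one_over divide_simps)
      finally have "real n * ?k * spread m \<le> real n * ?k * (1 / real n ^ 2)"
        by (intro mult_left_mono) auto
      also have "\<dots> = ?k / real n" using n by (simp add: power2_eq_square)
      finally have small: "real n * ?k * spread m < \<epsilon>" using elim by simp
      have "(MAX x0\<in>states n. tv_dist n (efcp_law \<Sigma> n x0 m) (efcp_pi \<Sigma> n)) < \<epsilon>"
      proof (subst Max_less_iff)
        show "\<forall>a\<in>(\<lambda>x0. tv_dist n (efcp_law \<Sigma> n x0 m) (efcp_pi \<Sigma> n)) ` states n. a < \<epsilon>"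
          using small tv_dist_efcp_pi_le[OF paintbox _ pi tv_dist_efcp_law_le]
          by (auto intro: le_less_trans)
      qed (auto simp: finite_states states_nonempty)
      then have "efcp_tmix \<Sigma> n \<epsilon> \<le> enat m"
        unfolding efcp_tmix_def using m0 by (intro INF_lower) (auto simp: m_def)
      then have "ereal_of_enat (efcp_tmix \<Sigma> n \<epsilon>) \<le> ereal (real m)"
        using ereal_of_enat_le_iff[of "efcp_tmix \<Sigma> n \<epsilon>" "enat m"] by simp
      moreover have "real m \<le> K * ln (real n)"
      proof -
        \<comment> \<open>From \<open>n \<ge> 3 \<ge> exp 1\<close> comes
          \<open>ln n \<ge> 1\<close>, so the additive 2 in
          \<open>Suc j \<le> 2 * log 2 n + 2\<close> is absorbed into a multiple of
          \<open>ln n\<close>. This explains the form of \<open>K\<close>.\<close>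
        have "1 = ln (exp 1 :: real)" by simp
        also have "\<dots> \<le> ln (real n)"
          using n exp_le by (subst ln_le_cancel_iff) auto
        finally have "real (Suc j) \<le> (2 / ln 2 + 2) * ln (real n)"
          using j by (simp add: log_def distrib_right)
        then show ?thesis unfolding m_def K_def
          by (simp only: of_nat_mult mult.assoc mult_left_mono of_nat_0_le_iff)
      qed
      ultimately show ?case by (meson ereal_less_eq(3) order_trans)
    qed
  qed
qed

end
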